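(* Let $M$ be a bicomplex Hilbert space with bicomplex scalar product $\langle\cdot|\cdot\rangle$ and induced norm $\|\cdot\|$. Let $\{|\psi_l\rangle\}_{l\ge 0}$ be an arbitrary orthonormal sequence in $M$, let $n\ge 0$, and let $\alpha_0,\ldots,\alpha_n\in\mathbb{M}(2)$ be bicomplex numbers. Then for all $|\psi\rangle\in M$, $$\Big\|\,|\psi\rangle-\sum_{l=0}^{n}\alpha_l|\psi_l\rangle\Big\|\ \ge\ \Big\|\,|\psi\rangle-\sum_{l=0}^{n}\langle\psi_l|\psi\rangle\,|\psi_l\rangle\Big\|.$$
   Context: Bicomplex numbers: $\mathbb{M}(2)=\{z_1+z_2\mathbf{i_2} : z_1,z_2\in\mathbb{C}(\mathbf{i_1})\}$, where $\mathbf{i_1},\mathbf{i_2}$ are independent commuting imaginary units with $\mathbf{i_1}^2=\mathbf{i_2}^2=-1$, and $\mathbb{C}(\mathbf{i_1})=\{x+y\mathbf{i_1}: x,y\in\mathbb{R}\}\cong\mathbb{C}$. Put $\mathbf{j}=\mathbf{i_1}\mathbf{i_2}$ (so $\mathbf{j}^2=1$). $\mathbb{M}(2)$ is a commutative ring. For $w=z_1+z_2\mathbf{i_2}$ the conjugate is $w^{\dagger_3}=\bar z_1-\bar z_2\mathbf{i_2}$ (bar is conjugation in $\mathbb{C}(\mathbf{i_1})$). Put $\mathbf{e_1}=(1+\mathbf{j})/2$, $\mathbf{e_2}=(1-\mathbf{j})/2$; these are idempotents with $\mathbf{e_1}+\mathbf{e_2}=1$, $\mathbf{e_1}\mathbf{e_2}=0$.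 Every $w$ is uniquely $w=P_1(w)\mathbf{e_1}+P_2(w)\mathbf{e_2}$ with $P_1(w)=z_1-z_2\mathbf{i_1}$, $P_2(w)=z_1+z_2\mathbf{i_1}$ in $\mathbb{C}(\mathbf{i_1})$. Let $\mathbb{D}_+=\{x\mathbf{e_1}+y\mathbf{e_2}: x,y\ge 0 \text{ real}\}$. Scalar product: for an $\mathbb{M}(2)$-module $M$ (elements are written $|\psi\rangle$), a bicomplex scalar product is a map $\langle\cdot|\cdot\rangle:M\times M\to\mathbb{M}(2)$, $(|\psi\rangle,|\phi\rangle)\mapsto\langle\psi|\phi\rangle$, that is additive and $\mathbb{M}(2)$-homogeneous in the second argument, satisfies $\langle\psi|\phi\rangle=\langle\phi|\psi\rangle^{\dagger_3}$, satisfies $\langle\psi|\psi\rangle=0\Leftrightarrow|\psi\rangle=0$, and is hyperbolic positive: $\langle\psi|\psi\rangle\in\mathbb{D}_+$ for all $|\psi\rangle$. The induced norm is $\|\,|\phi\rangle\|=\frac{1}{\sqrt2}\sqrt{P_1(\langle\phi|\phi\rangle)+P_2(\langle\phi|\phi\rangle)}$. A bicomplex Hilbert space is an $\mathbb{M}(2)$-module with a bicomplex scalar product that is complete for the induced norm. Standing convention: bicomplex Hilbert spaces are infinite dimensional, meaning that for every $n$ they contain $n$ elements that are linearly independent over $\mathbb{M}(2)$. A sequence $\{|\psi_l\rangle\}$ is orthonormal if $\langle\psi_l|\psi_m\rangle=\delta_{lm}$ (Kronecker delta, with value $1\in\mathbb{M}(2)$ for $l=m$). *)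

theory Defs
  imports Complex_Main
begin

text \<open>The bicomplex number \<open>Bicomplex z1 z2\<close> is \<open>z1 + z2 i2\<close>; the type \<open>complex\<close>
  plays the role of \<open>C(i1)\<close>, with \<open>\<i>\<close> as \<open>i1\<close>.\<close>

datatype bicomplex = Bicomplex (bc1: complex) (bc2: complex)

lemma bicomplex_eq_iff: "w = v \<longleftrightarrow> bc1 w = bc1 v \<and> bc2 w = bc2 v"
  by (cases w; cases v) auto

instantiation bicomplex :: comm_ring_1
begin

definition zero_bicomplex where "0 = Bicomplex 0 0"
definition one_bicomplex where "1 = Bicomplex 1 0"
definition plus_bicomplex where "w + v = Bicomplex (bc1 w + bc1 v) (bc2 w + bc2 v)"
definition uminus_bicomplex where "- w = Bicomplex (- bc1 w) (- bc2 w)"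
definition minus_bicomplex where "w - v = Bicomplex (bc1 w - bc1 v) (bc2 w - bc2 v)"
definition times_bicomplex where
  "w * v = Bicomplex (bc1 w * bc1 v - bc2 w * bc2 v) (bc1 w * bc2 v + bc2 w * bc1 v)"

instance
  by standard
    (simp_all add: zero_bicomplex_def one_bicomplex_def plus_bicomplex_def uminus_bicomplex_def
      minus_bicomplex_def times_bicomplex_def bicomplex_eq_iff algebra_simps)

end

lemma bicomplex_sel [simp]:
  "bc1 0 = 0" "bc2 0 = 0" "bc1 1 = 1" "bc2 1 = 0"
  "bc1 (w + v) = bc1 w + bc1 v" "bc2 (w + v) = bc2 w + bc2 v"
  "bc1 (- w) = - bc1 w" "bc2 (- w) = - bc2 w"
  "bc1 (w - v) = bc1 w - bc1 v" "bc2 (w - v) = bc2 w - bc2 v"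
  "bc1 (w * v) = bc1 w * bc1 v - bc2 w * bc2 v"
  "bc2 (w * v) = bc1 w * bc2 v + bc2 w * bc1 v"
  by (simp_all add: zero_bicomplex_def one_bicomplex_def plus_bicomplex_def uminus_bicomplex_def
      minus_bicomplex_def times_bicomplex_def)

definition bc_of_complex :: "complex \<Rightarrow> bicomplex" where
  "bc_of_complex z = Bicomplex z 0"

definition bc_i1 :: bicomplex where "bc_i1 = bc_of_complex \<i>"
definition bc_i2 :: bicomplex where "bc_i2 = Bicomplex 0 1"
definition bc_j :: bicomplex where "bc_j = bc_i1 * bc_i2"
definition bc_e1 :: bicomplex where "bc_e1 = bc_of_complex (1/2) * (1 + bc_j)"
definition bc_e2 :: bicomplex where "bc_e2 = bc_of_complex (1/2) * (1 - bc_j)"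

definition bc_cnj3 :: "bicomplex \<Rightarrow> bicomplex" where
  "bc_cnj3 w = bc_of_complex (cnj (bc1 w)) - bc_of_complex (cnj (bc2 w)) * bc_i2"

definition bc_P1 :: "bicomplex \<Rightarrow> complex" where "bc_P1 w = bc1 w - bc2 w * \<i>"
definition bc_P2 :: "bicomplex \<Rightarrow> complex" where "bc_P2 w = bc1 w + bc2 w * \<i>"

definition hyperbolic_nonneg :: "bicomplex set" where
  "hyperbolic_nonneg =
     {bc_of_complex (of_real x) * bc_e1 + bc_of_complex (of_real y) * bc_e2 | x y. x \<ge> 0 \<and> y \<ge> 0}"

lemmas bicomplex_basic_defs =
  bc_of_complex_def bc_i1_def bc_i2_def bc_j_def bc_e1_def bc_e2_def

lemma bicomplex_canonical: "w = bc_of_complex (bc1 w) + bc_of_complex (bc2 w) * bc_i2"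
  by (simp add: bicomplex_eq_iff bicomplex_basic_defs)

lemma bc_units_squared: "bc_i1 * bc_i1 = - 1" "bc_i2 * bc_i2 = - 1" "bc_j * bc_j = 1"
  by (simp_all add: bicomplex_eq_iff bicomplex_basic_defs)

lemma bc_idempotents:
  "bc_e1 * bc_e1 = bc_e1" "bc_e2 * bc_e2 = bc_e2" "bc_e1 + bc_e2 = 1" "bc_e1 * bc_e2 = 0"
  by (simp_all add: bicomplex_eq_iff bicomplex_basic_defs)

lemma bicomplex_idempotent_decomposition:
  "w = bc_of_complex (bc_P1 w) * bc_e1 + bc_of_complex (bc_P2 w) * bc_e2"
  by (simp add: bicomplex_eq_iff bicomplex_basic_defs bc_P1_def bc_P2_def field_simps)

text \<open>\<open>P1\<close> and \<open>P2\<close> take complex values. On \<open>hyperbolic_nonneg\<close>, where every \<open>ip \<phi> \<phi>\<close> lies,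
  both are nonnegative reals, so taking the real part loses nothing.\<close>

lemma hyperbolic_nonneg_P:
  assumes "w \<in> hyperbolic_nonneg"
  shows "bc_P1 w \<in> \<real>" "Re (bc_P1 w) \<ge> 0" "bc_P2 w \<in> \<real>" "Re (bc_P2 w) \<ge> 0"
proof -
  obtain x y :: real where xy: "x \<ge> 0" "y \<ge> 0"
    and w: "w = bc_of_complex (of_real x) * bc_e1 + bc_of_complex (of_real y) * bc_e2"
    using assms by (auto simp: hyperbolic_nonneg_def)
  have "bc_P1 w = of_real x" "bc_P2 w = of_real y"
    by (simp_all add: w bc_P1_def bc_P2_def bicomplex_basic_defs field_simps)
  then show "bc_P1 w \<in> \<real>" "Re (bc_P1 w) \<ge> 0" "bc_P2 w \<in> \<real>" "Re (bc_P2 w) \<ge> 0"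
    using xy by simp_all
qed

definition bc_norm :: "('a \<Rightarrow> 'a \<Rightarrow> bicomplex) \<Rightarrow> 'a \<Rightarrow> real" where
  "bc_norm ip \<phi> = (1 / sqrt 2) * sqrt (Re (bc_P1 (ip \<phi> \<phi>) + bc_P2 (ip \<phi> \<phi>)))"

locale bicomplex_scalar_product = module scale
  for scale :: "bicomplex \<Rightarrow> 'a::ab_group_add \<Rightarrow> 'a" +
  fixes ip :: "'a \<Rightarrow> 'a \<Rightarrow> bicomplex"
  assumes ip_add_right: "ip \<psi> (\<phi> + \<chi>) = ip \<psi> \<phi> + ip \<psi> \<chi>"
    and ip_scale_right: "ip \<psi> (scale \<alpha> \<phi>) = \<alpha> * ip \<psi> \<phi>"
    and ip_cnj3: "ip \<psi> \<phi> = bc_cnj3 (ip \<phi> \<psi>)"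
    and ip_eq_zero_iff: "ip \<psi> \<psi> = 0 \<longleftrightarrow> \<psi> = 0"
    and ip_hyperbolic_nonneg: "ip \<psi> \<psi> \<in> hyperbolic_nonneg"

text \<open>As in the source, Hilbert spaces are infinite dimensional. Linear independence is
  that of the locale \<open>module\<close>, i.e. over the whole ring of bicomplex scalars.\<close>

locale bicomplex_hilbert_space = bicomplex_scalar_product scale ip
  for scale :: "bicomplex \<Rightarrow> 'a::ab_group_add \<Rightarrow> 'a" and ip :: "'a \<Rightarrow> 'a \<Rightarrow> bicomplex" +
  assumes complete:
      "\<forall>e>0. \<exists>N. \<forall>m\<ge>N. \<forall>n\<ge>N. bc_norm ip (X m - X n) < e
        \<Longrightarrow> \<exists>L. (\<lambda>n. bc_norm ip (X n - L)) \<longlonglongrightarrow> 0"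
    and infinite_dimensional: "\<exists>S. finite S \<and> card S = n \<and> independent S"

definition bc_orthonormal :: "('a \<Rightarrow> 'a \<Rightarrow> bicomplex) \<Rightarrow> (nat \<Rightarrow> 'a) \<Rightarrow> bool" where
  "bc_orthonormal ip \<psi>s \<longleftrightarrow> (\<forall>l m. ip (\<psi>s l) (\<psi>s m) = (if l = m then 1 else 0))"

end

theory Submission
  imports Defs
begin

text \<open>The residual \<open>r = \<psi> - (\<Sum>l=0..n. \<langle>\<psi>\<^sub>l|\<psi>\<rangle> \<psi>\<^sub>l)\<close> is orthogonal to every \<open>\<psi>\<^sub>l\<close>, and any other
  approximation error differs from \<open>r\<close> by a combination \<open>d\<close> of the \<open>\<psi>\<^sub>l\<close>. Pythagoras gives
  \<open>\<langle>r + d|r + d\<rangle> = \<langle>r|r\<rangle> + \<langle>d|d\<rangle>\<close>, where \<open>\<langle>d|d\<rangle>\<close> is hyperbolic nonnegative.\<close>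

lemma bc_cnj3_zero [simp]: "bc_cnj3 0 = 0"
  by (simp add: bc_cnj3_def bicomplex_eq_iff bicomplex_basic_defs)

lemma bc_cnj3_add: "bc_cnj3 (w + v) = bc_cnj3 w + bc_cnj3 v"
  by (simp add: bc_cnj3_def bicomplex_eq_iff bicomplex_basic_defs)

lemma bc_P1_add: "bc_P1 (w + v) = bc_P1 w + bc_P1 v"
  by (simp add: bc_P1_def algebra_simps)

lemma bc_P2_add: "bc_P2 (w + v) = bc_P2 w + bc_P2 v"
  by (simp add: bc_P2_def algebra_simps)

context bicomplex_scalar_product
begin

lemma ip_add_left: "ip (\<phi> + \<chi>) \<psi> = ip \<phi> \<psi> + ip \<chi> \<psi>"
  by (metis ip_cnj3 ip_add_right bc_cnj3_add)

lemma ip_zero_right [simp]: "ip \<psi> 0 = 0"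
  using ip_add_right[of \<psi> 0 0] by simp

lemma ip_diff_right: "ip \<psi> (\<phi> - \<chi>) = ip \<psi> \<phi> - ip \<psi> \<chi>"
  using ip_add_right[of \<psi> "\<phi> - \<chi>" \<chi>] by simp

lemma ip_sum_scale_right:
  "ip \<psi> (\<Sum>l\<in>A. scale (\<beta> l) (\<phi> l)) = (\<Sum>l\<in>A. \<beta> l * ip \<psi> (\<phi> l))"
  by (induction A rule: infinite_finite_induct) (simp_all add: ip_add_right ip_scale_right)

text \<open>Conjugate symmetry together with \<open>bc_cnj3 0 = 0\<close> makes orthogonality a
  symmetric relation.\<close>

lemma ip_eq_zero_commute: "ip \<psi> \<phi> = 0 \<longleftrightarrow> ip \<phi> \<psi> = 0"
  by (metis ip_cnj3 bc_cnj3_zero)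

lemma bc_norm_le_add_orthogonal:
  assumes "ip r d = 0"
  shows "bc_norm ip r \<le> bc_norm ip (r + d)"
proof -
  have "ip d r = 0"
    using assms by (simp add: ip_eq_zero_commute)
  then have "ip (r + d) (r + d) = ip r r + ip d d"
    using assms by (simp add: ip_add_left ip_add_right)
  \<comment> \<open>\<open>bc_P1\<close> and \<open>bc_P2\<close> are additive and have nonnegative
    real parts at \<open>ip d d\<close>, so the quantity under the root can only grow.\<close>
  then show ?thesis
    using hyperbolic_nonneg_P(2,4)[OF ip_hyperbolic_nonneg[of d]]
    by (simp add: bc_norm_def bc_P1_add bc_P2_add divide_right_mono)
qed

lemma ip_residual_orthonormal:
  assumes "bc_orthonormal ip \<psi>s" "finite A" "l \<in> A"
  shows "ip (\<psi> - (\<Sum>k\<in>A. scale (ip (\<psi>s k) \<psi>) (\<psi>s k))) (\<psi>s l) = 0"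
proof -
  have "(\<Sum>k\<in>A. ip (\<psi>s k) \<psi> * ip (\<psi>s l) (\<psi>s k)) = (\<Sum>k\<in>A. if l = k then ip (\<psi>s k) \<psi> else 0)"
    using assms(1) by (intro sum.cong) (auto simp: bc_orthonormal_def)
  \<comment> \<open>Swapping the arguments moves the residual into the linear slot; the sum
    collapses to its term at \<open>l\<close>, which cancels
    \<open>ip (\<psi>s l) \<psi>\<close>.\<close>
  then show ?thesis
    using assms(2,3)
    by (subst ip_eq_zero_commute) (simp add: ip_diff_right ip_sum_scale_right sum.delta')
qed

lemma bc_norm_residual_le:
  assumes "bc_orthonormal ip \<psi>s" "finite A"
  shows "bc_norm ip (\<psi> - (\<Sum>l\<in>A. scale (ip (\<psi>s l) \<psi>) (\<psi>s l)))
       \<le> bc_norm ip (\<psi> - (\<Sum>l\<in>A. scale (\<alpha> l) (\<psi>s l)))"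
proof -
  let ?r = "\<psi> - (\<Sum>l\<in>A. scale (ip (\<psi>s l) \<psi>) (\<psi>s l))"
  \<comment> \<open>These coefficients are chosen so that adding \<open>?d\<close> to
    \<open>?r\<close> trades each \<open>ip (\<psi>s l) \<psi>\<close> for
    \<open>\<alpha> l\<close>.\<close>
  let ?d = "\<Sum>l\<in>A. scale (ip (\<psi>s l) \<psi> - \<alpha> l) (\<psi>s l)"
  \<comment> \<open>Linearity in the second slot reduces this to
    \<open>ip ?r (\<psi>s l) = 0\<close> for \<open>l\<close> in \<open>A\<close>.\<close>
  have "ip ?r ?d = 0"
    using ip_residual_orthonormal[OF assms] by (simp add: ip_sum_scale_right)
  moreover have "?r + ?d = \<psi> - (\<Sum>l\<in>A. scale (\<alpha> l) (\<psi>s l))"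
    by (simp add: scale_left_diff_distrib sum_subtractf)
  ultimately show ?thesis
    using bc_norm_le_add_orthogonal[of ?r ?d] by metis
qed

end

theorem theorem3p4:
  fixes scale :: "bicomplex \<Rightarrow> 'a::ab_group_add \<Rightarrow> 'a"
    and ip :: "'a \<Rightarrow> 'a \<Rightarrow> bicomplex"
    and \<psi>s :: "nat \<Rightarrow> 'a" and n :: nat and \<alpha> :: "nat \<Rightarrow> bicomplex" and \<psi> :: 'a
  assumes "bicomplex_hilbert_space scale ip"
    and "bc_orthonormal ip \<psi>s"
  shows "bc_norm ip (\<psi> - (\<Sum>l=0..n. scale (\<alpha> l) (\<psi>s l)))
       \<ge> bc_norm ip (\<psi> - (\<Sum>l=0..n. scale (ip (\<psi>s l) \<psi>) (\<psi>s l)))"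
proof -
  interpret bicomplex_hilbert_space scale ip
    by fact
  show ?thesis
    using assms(2) by (intro bc_norm_residual_le) auto
qed

end
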